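(* Let $(X,X_+)$ be a pre-Riesz space. Assume that every non-empty totally ordered subset of $X$ that is bounded from above has a supremum in $X$. If $X$ is weakly pervasive, then $X$ is a lattice (i.e., any two elements of $X$ have a supremum and an infimum in $X$).
   Context: An ordered vector space $(X,X_+)$ is a real vector space $X$ with a non-empty set $X_+ \subseteq X$ such that $X_+ \cap (-X_+) = \{0\}$ and $\alpha X_+ + \beta X_+ \subseteq X_+$ for all $\alpha,\beta \in [0,\infty)$; one writes $x \le y$ if $y - x \in X_+$, and $[x,z] := \{y \in X : x \le y \le z\}$. It is a pre-Riesz space if for every non-empty finite set $A \subseteq X$ and every $x \in X$: if every upper bound of $x + A$ is an upper bound of $A$, then $x \in X_+$. Two elements $x,y \in X$ are disjoint, $x \perp y$, if the sets $\{x+y,-x-y\}$ and $\{x-y,y-x\}$ have the same set of upper bounds in $X$ (for $x,y \in X_+$ this is equivalent to $\inf\{x,y\}$ existing in $X$ and being $0$). Two vectors $x,y \in X_+$ are D-disjoint if $[0,x] \cap [0,y] = \{0\}$. A pre-Riesz space $X$ is weakly pervasive if any two D-disjoint vectors in $X_+$ are disjoint. *)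

theory Defs
  imports Complex_Main "HOL-Library.Lub_Glb"
begin

text \<open>
  Ordered vector spaces are the instances of \<^class>\<open>ordered_real_vector\<close>: the cone is
  \<open>X\<^sub>+ = {x. 0 \<le> x}\<close>, and \<open>isLub UNIV A\<close>, \<open>isGlb UNIV A\<close> express suprema and infima of
  \<open>A\<close> in \<open>X\<close>.
\<close>

definition upper_bounds :: "'a::ord set \<Rightarrow> 'a set" where
  "upper_bounds A = {b. isUb UNIV A b}"

definition pre_riesz :: "'a::ordered_real_vector itself \<Rightarrow> bool" where
  "pre_riesz _ \<longleftrightarrow> (\<forall>(A :: 'a set) x. finite A \<longrightarrow> A \<noteq> {} \<longrightarrow>
     upper_bounds ((\<lambda>a. x + a) ` A) \<subseteq> upper_bounds A \<longrightarrow> 0 \<le> x)"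

definition disjoint_vectors :: "'a::ordered_real_vector \<Rightarrow> 'a \<Rightarrow> bool" where
  "disjoint_vectors x y \<longleftrightarrow> upper_bounds {x + y, - x - y} = upper_bounds {x - y, y - x}"

definition D_disjoint :: "'a::ordered_real_vector \<Rightarrow> 'a \<Rightarrow> bool" where
  "D_disjoint x y \<longleftrightarrow> 0 \<le> x \<and> 0 \<le> y \<and> {0..x} \<inter> {0..y} = {0}"

definition weakly_pervasive :: "'a::ordered_real_vector itself \<Rightarrow> bool" where
  "weakly_pervasive _ \<longleftrightarrow> (\<forall>x y :: 'a. D_disjoint x y \<longrightarrow> disjoint_vectors x y)"

end

theory Submission
  imports Defs
begin

text \<open>
  Above any lower bound of \<open>{x, y}\<close> Zorn's lemma yields a maximal lower bound \<open>m\<close>. Maximality says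
  precisely that \<open>x - m\<close> and \<open>y - m\<close> are D-disjoint; weak pervasiveness makes them disjoint, so
  their infimum is \<open>0\<close>, that is, \<open>m\<close> is the infimum of \<open>{x, y}\<close>. Lower bounds exist because
  pre-Riesz spaces are directed.
\<close>

lemma isLub_pair_iff:
  fixes x y s :: "'a::order"
  shows "isLub UNIV {x, y} s \<longleftrightarrow> x \<le> s \<and> y \<le> s \<and> (\<forall>b. x \<le> b \<longrightarrow> y \<le> b \<longrightarrow> s \<le> b)"
  by (auto simp: isLub_def leastP_def isUb_def setle_def setge_def)

lemma isGlb_pair_iff:
  fixes x y i :: "'a::order"
  shows "isGlb UNIV {x, y} i \<longleftrightarrow> i \<le> x \<and> i \<le> y \<and> (\<forall>b. b \<le> x \<longrightarrow> b \<le> y \<longrightarrow> b \<le> i)"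
  by (auto simp: isGlb_def greatestP_def isLb_def setle_def setge_def)

text \<open>Negation reverses the order and so exchanges upper and lower bounds; hence only infima
  need to be constructed.\<close>

lemma isLub_pair_if_isGlb_uminus:
  fixes x y i :: "'a::ordered_ab_group_add"
  assumes "isGlb UNIV {- x, - y} i"
  shows "isLub UNIV {x, y} (- i)"
proof -
  from assms have i: "i \<le> - x" "i \<le> - y" and greatest: "\<And>b. b \<le> - x \<Longrightarrow> b \<le> - y \<Longrightarrow> b \<le> i"
    by (auto simp: isGlb_pair_iff)
  have "- i \<le> b" if "x \<le> b" "y \<le> b" for b
    using greatest[of "- b"] that by (simp add: minus_le_iff)
  moreover have "x \<le> - i" "y \<le> - i"
    using i by (simp_all add: le_minus_iff)
  ultimately show ?thesis by (auto simp: isLub_pair_iff)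
qed

text \<open>If \<open>{x, y}\<close> had no upper bound, the pre-Riesz condition would hold vacuously for every
  translate, so every vector would be positive and \<open>X = {0}\<close>.\<close>

lemma pre_riesz_imp_upper_bound:
  fixes x y :: "'a::ordered_real_vector"
  assumes "pre_riesz TYPE('a)"
  shows "\<exists>b. x \<le> b \<and> y \<le> b"
proof (rule ccontr)
  assume no_ub: "\<nexists>b. x \<le> b \<and> y \<le> b"
  have "0 \<le> z" for z :: 'a
  proof -
    have "upper_bounds ((\<lambda>a. z + a) ` {x, y}) = {}"
    proof (rule equals0I)
      fix b assume "b \<in> upper_bounds ((\<lambda>a. z + a) ` {x, y})"
      then have "x \<le> b - z" "y \<le> b - z"
        by (auto simp: upper_bounds_def isUb_def setle_def le_diff_eq add.commute)
      with no_ub show False by blast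
    qed
    then have "upper_bounds ((\<lambda>a. z + a) ` {x, y}) \<subseteq> upper_bounds {x, y}" by blast
    moreover have "finite {x, y}" "{x, y} \<noteq> {}" by simp_all
    ultimately show ?thesis using assms unfolding pre_riesz_def by blast
  qed
  \<comment> \<open>Positivity of \<open>y - x\<close> would make \<open>y\<close> itself an upper
    bound of the pair.\<close>
  from this[of "y - x"] have "x \<le> y" by simp
  with no_ub show False by blast
qed

lemma pre_riesz_imp_lower_bound:
  fixes x y :: "'a::ordered_real_vector"
  assumes "pre_riesz TYPE('a)"
  shows "\<exists>b. b \<le> x \<and> b \<le> y"
proof -
  obtain b where "- x \<le> b" "- y \<le> b"
    using pre_riesz_imp_upper_bound[OF assms] by blast
  then have "- b \<le> x" "- b \<le> y" by (simp_all add: minus_le_iff)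
  then show ?thesis by blast
qed

text \<open>A lower bound \<open>w\<close> of \<open>{x, y}\<close> makes \<open>x + y - 2 w\<close> an upper bound of \<open>{x - y, y - x}\<close>.\<close>

lemma disjoint_vectors_lower_bound_nonpos:
  fixes x y w :: "'a::ordered_real_vector"
  assumes "disjoint_vectors x y" "w \<le> x" "w \<le> y"
  shows "w \<le> 0"
proof -
  have "x + y - (w + w) - (x - y) = (y - w) + (y - w)"
    and "x + y - (w + w) - (y - x) = (x - w) + (x - w)"
    by (simp_all add: algebra_simps)
  moreover have "0 \<le> (y - w) + (y - w)" "0 \<le> (x - w) + (x - w)"
    using assms(2,3) by (simp_all add: add_nonneg_nonneg)
  ultimately have "x - y \<le> x + y - (w + w)" "y - x \<le> x + y - (w + w)"
    by (metis diff_ge_0_iff_ge)+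
  then have "x + y - (w + w) \<in> upper_bounds {x - y, y - x}"
    by (auto simp: upper_bounds_def isUb_def setle_def)
  \<comment> \<open>Disjointness transfers the bound to \<open>x + y\<close>; cancelling
    \<open>x + y\<close> then leaves \<open>w + w \<le> 0\<close>.\<close>
  then have "x + y - (w + w) \<in> upper_bounds {x + y, - x - y}"
    using assms(1) by (simp add: disjoint_vectors_def)
  then have "x + y \<le> x + y - (w + w)"
    by (simp add: upper_bounds_def isUb_def setle_def)
  then have "w + w \<le> 0" by (simp add: le_diff_eq)
  then have "(1/2) *\<^sub>R (w + w) \<le> (1/2) *\<^sub>R 0"
    by (intro scaleR_left_mono) simp_all
  then show ?thesis by (simp flip: scaleR_2)
qed

text \<open>Zorn's lemma applies to the set \<open>L\<close> of lower bounds: a non-empty chain in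
  \<open>L\<close> is bounded above by \<open>x\<close>, so it has a supremum, and this stays in
  \<open>L\<close> because \<open>x\<close> and \<open>y\<close> are both upper bounds of the
  chain.\<close>

lemma ex_maximal_lower_bound:
  fixes x y l :: "'a::order"
  assumes chain_sup: "\<And>C :: 'a set.
      \<lbrakk>C \<noteq> {}; Complete_Partial_Order.chain (\<le>) C; bdd_above C\<rbrakk> \<Longrightarrow> \<exists>s. isLub UNIV C s"
    and l: "l \<le> x" "l \<le> y"
  obtains m where "m \<le> x" "m \<le> y" "\<And>b. b \<le> x \<Longrightarrow> b \<le> y \<Longrightarrow> m \<le> b \<Longrightarrow> b = m"
proof -
  define L where "L = {b. b \<le> x \<and> b \<le> y}"
  have "partial_order_on L (relation_of (\<le>) L)"
    by (rule partial_order_on_relation_ofI) auto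
  moreover have "\<exists>u\<in>L. \<forall>a\<in>C. a \<le> u" if C: "C \<in> Chains (relation_of (\<le>) L)" for C
  proof (cases "C = {}")
    case True
    \<comment> \<open>The assumption on suprema says nothing about the empty chain; here
      \<open>l\<close> serves as its upper bound in \<open>L\<close>.\<close>
    with l show ?thesis by (auto simp: L_def)
  next
    case False
    from C have sub: "C \<subseteq> L" and ch: "Complete_Partial_Order.chain (\<le>) C"
      by (auto simp: Chains_def relation_of_def Complete_Partial_Order.chain_def)
    from sub have "bdd_above C" by (auto simp: L_def bdd_above_def)
    with chain_sup False ch obtain s where s: "isLub UNIV C s" by blast
    have "s \<le> b" if "\<forall>c\<in>C. c \<le> b" for b
      using isLub_le_isUb[OF s] that by (simp add: isUb_def setle_def)
    with sub have "s \<in> L" by (auto simp: L_def)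
    moreover have "\<forall>a\<in>C. a \<le> s" using isLubD2[OF s] by blast
    ultimately show ?thesis by blast
  qed
  ultimately obtain m where "m \<in> L" "\<forall>a\<in>L. m \<le> a \<longrightarrow> a = m"
    using predicate_Zorn[of L "(\<le>)"] by blast
  then show thesis using that by (auto simp: L_def)
qed

text \<open>A vector \<open>z \<ge> 0\<close> below both \<open>x - m\<close> and
  \<open>y - m\<close> gives a lower bound \<open>m + z\<close> of \<open>{x, y}\<close> above
  \<open>m\<close>, so maximality forces \<open>z = 0\<close>.\<close>

lemma maximal_lower_bound_imp_D_disjoint:
  fixes x y m :: "'a::ordered_real_vector"
  assumes m: "m \<le> x" "m \<le> y"
    and maximal: "\<And>b. b \<le> x \<Longrightarrow> b \<le> y \<Longrightarrow> m \<le> b \<Longrightarrow> b = m"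
  shows "D_disjoint (x - m) (y - m)"
proof -
  have "z = 0" if "0 \<le> z" "z \<le> x - m" "z \<le> y - m" for z
    using maximal[of "m + z"] that by (simp add: le_diff_eq add.commute)
  with m show ?thesis by (auto simp: D_disjoint_def)
qed

lemma ex_isGlb_pair:
  fixes x y :: "'a::ordered_real_vector"
  assumes "pre_riesz TYPE('a)"
    and chain_sup: "\<And>C :: 'a set.
      \<lbrakk>C \<noteq> {}; Complete_Partial_Order.chain (\<le>) C; bdd_above C\<rbrakk> \<Longrightarrow> \<exists>s. isLub UNIV C s"
    and "weakly_pervasive TYPE('a)"
  shows "\<exists>i. isGlb UNIV {x, y} i"
proof -
  obtain l where "l \<le> x" "l \<le> y"
    using pre_riesz_imp_lower_bound[OF assms(1)] by blast
  then obtain m where m: "m \<le> x" "m \<le> y" "\<And>b. b \<le> x \<Longrightarrow> b \<le> y \<Longrightarrow> m \<le> b \<Longrightarrow> b = m"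
    using ex_maximal_lower_bound[OF chain_sup] by blast
  then have disj: "disjoint_vectors (x - m) (y - m)"
    using maximal_lower_bound_imp_D_disjoint[of m x y] assms(3)
    unfolding weakly_pervasive_def by blast
  \<comment> \<open>Translation by \<open>- m\<close> turns \<open>b\<close> into a lower bound of
    the disjoint vectors \<open>x - m\<close> and \<open>y - m\<close>. Thus \<open>m\<close>
    dominates every lower bound, also those not comparable to it beforehand.\<close>
  have "b \<le> m" if "b \<le> x" "b \<le> y" for b
    using disjoint_vectors_lower_bound_nonpos[OF disj, of "b - m"] that by simp
  with m show ?thesis by (auto simp: isGlb_pair_iff)
qed

theorem theorem4p12:
  assumes "pre_riesz TYPE('a::ordered_real_vector)"
    and "\<And>C :: 'a set.
      \<lbrakk>C \<noteq> {}; Complete_Partial_Order.chain (\<le>) C; bdd_above C\<rbrakk> \<Longrightarrow> \<exists>s. isLub UNIV C s"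
    and "weakly_pervasive TYPE('a)"
  shows "\<forall>x y :: 'a. (\<exists>s. isLub UNIV {x, y} s) \<and> (\<exists>i. isGlb UNIV {x, y} i)"
  using ex_isGlb_pair[OF assms] isLub_pair_if_isGlb_uminus by blast

end
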